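(* Let $X$ be a perfect Polish space and let $A\subseteq X$. The following are equivalent: (1) $A$ is countably perfectly meager in $X$. (2) For every sequence $\{K_n : n\in\mathbb{N}\}$ of copies of the Cantor set in $X$ there is an $F_\sigma$-set $F$ in $X$ such that $A\subseteq F$ and $K_m\not\subseteq F$ for each $m\in\mathbb{N}$. (3) For every sequence $\{K_n : n\in\mathbb{N}\}$ of copies of the Cantor set in $X$ there are closed sets $F_n$ in $X$ ($n\in\mathbb{N}$) such that $A\subseteq\bigcup_n F_n$ and $K_m\not\subseteq F_n$ for each $m,n\in\mathbb{N}$. (4) For every sequence $\{K_n : n\in\mathbb{N}\}$ of pairwise disjoint copies of the Cantor set in $X$ there are closed sets $F_n$ in $X$ ($n\in\mathbb{N}$) such that $A\subseteq\bigcup_n F_n$ and $K_m\not\subseteq F_n$ for each $m,n\in\mathbb{N}$. (5) $A$ is an $s_0$-set and for every sequence $\{K_n : n\in\mathbb{N}\}$ of pairwise disjoint and disjoint from $A$ copies of the Cantor set in $X$ there are closed sets $F_n$ in $X$ ($n\in\mathbb{N}$) such that $A\subseteq\bigcup_n F_n$ and $K_m\not\subseteq F_n$ for each $m,n\in\mathbb{N}$.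
   Context: A perfect Polish space is a separable completely metrizable topological space with no isolated points. A perfect set is a non-empty closed set with no isolated points. A copy of the Cantor set in $X$ is a subset of $X$ homeomorphic to $2^{\mathbb{N}}$. A subset $A$ of a perfect Polish space $X$ is countably perfectly meager in $X$ if for every sequence $\{P_n : n\in\mathbb{N}\}$ of perfect subsets of $X$ there exists an $F_\sigma$-set $F$ in $X$ such that $A\subseteq F$ and $F\cap P_n$ is meager in $P_n$ for each $n$. The set $A$ is an $s_0$-set if for every perfect set $P\subseteq X$ there is a copy of the Cantor set $K\subseteq P$ with $K\cap A=\emptyset$. *)

theory Defs
  imports "HOL-Analysis.Analysis"
begin

definition no_isolated_points :: "'a topology \<Rightarrow> bool" where
  "no_isolated_points X \<longleftrightarrow> (\<forall>x \<in> topspace X. \<not> openin X {x})"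

(* As in the source, the empty space is not excluded. *)
definition perfect_Polish_space :: "'a topology \<Rightarrow> bool" where
  "perfect_Polish_space X \<longleftrightarrow>
     separable_space X \<and> completely_metrizable_space X \<and> no_isolated_points X"

definition perfect_set :: "'a topology \<Rightarrow> 'a set \<Rightarrow> bool" where
  "perfect_set X P \<longleftrightarrow>
     closedin X P \<and> P \<noteq> {} \<and> no_isolated_points (subtopology X P)"

definition Cantor_space :: "(nat \<Rightarrow> bool) topology" where
  "Cantor_space = product_topology (\<lambda>_. discrete_topology UNIV) UNIV"

definition Cantor_copy :: "'a topology \<Rightarrow> 'a set \<Rightarrow> bool" where
  "Cantor_copy X K \<longleftrightarrow>
     K \<subseteq> topspace X \<and> subtopology X K homeomorphic_space Cantor_space"

definition nowhere_dense_in :: "'a topology \<Rightarrow> 'a set \<Rightarrow> bool" where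
  "nowhere_dense_in X S \<longleftrightarrow> S \<subseteq> topspace X \<and> X interior_of (X closure_of S) = {}"

definition meager_in :: "'a topology \<Rightarrow> 'a set \<Rightarrow> bool" where
  "meager_in X = countable union_of nowhere_dense_in X"

definition countably_perfectly_meager :: "'a topology \<Rightarrow> 'a set \<Rightarrow> bool" where
  "countably_perfectly_meager X A \<longleftrightarrow> A \<subseteq> topspace X \<and>
     (\<forall>P :: nat \<Rightarrow> 'a set. (\<forall>n. perfect_set X (P n)) \<longrightarrow>
        (\<exists>F. fsigma_in X F \<and> A \<subseteq> F \<and> (\<forall>n. meager_in (subtopology X (P n)) (F \<inter> P n))))"

definition s0_set :: "'a topology \<Rightarrow> 'a set \<Rightarrow> bool" where
  "s0_set X A \<longleftrightarrow> A \<subseteq> topspace X \<and>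
     (\<forall>P. perfect_set X P \<longrightarrow> (\<exists>K. Cantor_copy X K \<and> K \<subseteq> P \<and> K \<inter> A = {}))"

end

theory Submission
  imports Defs
begin

text \<open>Clearly an \<open>F\<^sub>\<sigma>\<close>-cover of \<open>A\<close> containing no \<open>K m\<close> splits into closed sets with the same
  property, and restricting the sequences \<open>K\<close> (to disjoint ones, or to those disjoint from \<open>A\<close>)
  only weakens a covering condition. What remains rests on two constructions.

  The first is a Cantor scheme (\<open>Cantor_copy_in_perfect_set_avoiding\<close>): in a completely
  metrizable space every non-empty relatively open part of a perfect set contains a copy of the
  Cantor set that misses countably many prescribed closed sets, provided that these are nowhere
  dense in the perfect set. Hence a set meager in a perfect set \<open>P\<close> is disjoint from some copy of
  the Cantor set inside \<open>P\<close>. Since copies of the Cantor set are themselves perfect, a countably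
  perfectly meager set has an \<open>F\<^sub>\<sigma>\<close>-cover containing none of the given copies, and it is an
  \<open>s\<^sub>0\<close>-set. Without sets to avoid, the scheme also leads from covers back to countable perfect
  meagerness (\<open>countably_perfectly_meager_if_closed_covers\<close>): put a copy of the Cantor set into
  every non-empty trace of a basic open set on each of the given perfect sets. A closed set
  containing none of these copies is nowhere dense in all the perfect sets.

  The second is a disjoint refinement (\<open>Cantor_copies_disjoint_refinement\<close>): any sequence of
  copies \<open>L n\<close> can be shrunk to pairwise disjoint copies \<open>K n \<subseteq> L n\<close>. A closed set that
  contains no \<open>K n\<close> contains no \<open>L n\<close> either, so covers for disjoint sequences serve arbitrary
  ones. If covers are available only for sequences disjoint from \<open>A\<close>, the \<open>s\<^sub>0\<close> property first
  replaces each \<open>L n\<close> by a copy inside it that is disjoint from \<open>A\<close>.\<close>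

section \<open>The Cantor space and its copies\<close>

lemma topspace_Cantor_space [simp]: "topspace Cantor_space = UNIV"
  by (simp add: Cantor_space_def)

lemma compact_space_Cantor_space: "compact_space Cantor_space"
  unfolding Cantor_space_def
  by (simp add: compact_space_product_topology compact_space_discrete_topology)

lemma openin_Cantor_cylinder: "openin Cantor_space {w. \<forall>i<n. w i = z i}"
proof -
  have "{w. \<forall>i<n. w i = z i} = PiE UNIV (\<lambda>i. if i < n then {z i} else UNIV)"
    by (auto simp: PiE_def Pi_def split: if_splits)
  moreover have "finite {i. (if i < n then {z i} else UNIV) \<noteq> (UNIV :: bool set)}"
    by (rule finite_subset [of _ "{..<n}"]) auto
  ultimately show ?thesis
    unfolding Cantor_space_def by (auto simp: openin_PiE_gen)
qed

lemma not_openin_Cantor_singleton: "\<not> openin Cantor_space {z}"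
proof
  assume "openin Cantor_space {z}"
  then obtain V where fin: "finite {i. V i \<noteq> (UNIV :: bool set)}"
      and z: "z \<in> PiE UNIV V" and sub: "PiE UNIV V \<subseteq> {z}"
    by (auto simp: Cantor_space_def openin_product_topology_alt)
  obtain i where i: "V i = UNIV"
    using fin ex_new_if_finite infinite_UNIV_nat by fastforce
  have "z(i := \<not> z i) \<in> PiE UNIV V"
    using z i by (auto simp: PiE_def Pi_def)
  with sub have "z(i := \<not> z i) = z"
    by blast
  then show False
    by (metis fun_upd_same)
qed

text \<open>Compactness of the Cantor space makes continuous injections into Hausdorff spaces
  embeddings, so copies of the Cantor set may be produced and taken apart through such maps.\<close>

lemma Cantor_copy_iff:
  assumes "Hausdorff_space X"
  shows "Cantor_copy X K \<longleftrightarrow> (\<exists>h. continuous_map Cantor_space X h \<and> inj h \<and> range h = K)"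
proof
  assume "Cantor_copy X K"
  then have sub: "K \<subseteq> topspace X" and "Cantor_space homeomorphic_space subtopology X K"
    unfolding Cantor_copy_def by (blast intro: homeomorphic_space_sym [THEN iffD1])+
  then obtain h where h: "homeomorphic_map Cantor_space (subtopology X K) h"
    by (auto simp: homeomorphic_space)
  then have "continuous_map Cantor_space X h"
    using continuous_map_in_subtopology homeomorphic_imp_continuous_map by blast
  moreover have "inj h"
    using homeomorphic_imp_injective_map [OF h] by simp
  moreover have "range h = K"
    using homeomorphic_imp_surjective_map [OF h] sub by (simp add: Int_absorb1)
  ultimately show "\<exists>h. continuous_map Cantor_space X h \<and> inj h \<and> range h = K"
    by blast
next
  assume "\<exists>h. continuous_map Cantor_space X h \<and> inj h \<and> range h = K"
  then obtain h where h: "continuous_map Cantor_space X h" "inj h" "range h = K"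
    by blast
  then have "embedding_map Cantor_space X h"
    using assms compact_space_Cantor_space by (simp add: continuous_imp_embedding_map)
  then have "Cantor_space homeomorphic_space subtopology X K"
    using h by (auto simp: embedding_map_def homeomorphic_space)
  moreover have "K \<subseteq> topspace X"
    using h continuous_map_image_subset_topspace by fastforce
  ultimately show "Cantor_copy X K"
    unfolding Cantor_copy_def by (blast intro: homeomorphic_space_sym [THEN iffD1])
qed

lemma perfect_set_Cantor_copy:
  assumes "Hausdorff_space X" "Cantor_copy X K"
  shows "perfect_set X K"
proof -
  obtain h where h: "continuous_map Cantor_space X h" "inj h" "range h = K"
    using assms Cantor_copy_iff by blast
  have "compactin X K"
    using image_compactin [of Cantor_space UNIV X h] h compact_space_Cantor_space
    by (simp add: compact_space_def)
  then have "closedin X K"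
    using assms(1) compactin_imp_closedin by blast
  moreover have "no_isolated_points (subtopology X K)"
    unfolding no_isolated_points_def
  proof (intro ballI notI)
    fix x assume x: "x \<in> topspace (subtopology X K)" and op: "openin (subtopology X K) {x}"
    then obtain z where z: "x = h z"
      using h by auto
    have "continuous_map Cantor_space (subtopology X K) h"
      using h by (auto simp: continuous_map_in_subtopology)
    then have "openin Cantor_space {w \<in> topspace Cantor_space. h w \<in> {x}}"
      using op openin_continuous_map_preimage by blast
    moreover have "{w \<in> topspace Cantor_space. h w \<in> {x}} = {z}"
      using z h(2) by (auto dest: injD)
    ultimately show False
      using not_openin_Cantor_singleton by simp
  qed
  ultimately show ?thesis
    using h(3) by (auto simp: perfect_set_def)
qed

text \<open>The homeomorphism of the Cantor space with its square, which interleaves two sequences,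
  partitions every copy of the Cantor set into fibres that are again copies of it.\<close>

lemma Cantor_copy_fibres:
  assumes X: "Hausdorff_space X" and L: "Cantor_copy X L"
  obtains K :: "(nat \<Rightarrow> bool) \<Rightarrow> 'a set"
  where "\<And>z. Cantor_copy X (K z)" "\<And>z. K z \<subseteq> L" "disjoint_family K"
proof -
  obtain h where h: "continuous_map Cantor_space X h" "inj h" "range h = L"
    using assms Cantor_copy_iff by blast
  define j where "j z w i = (if even i then z (i div 2) else w (i div 2))"
    for z w :: "nat \<Rightarrow> bool" and i
  have j_even: "j z w (2 * i) = z i" and j_odd: "j z w (Suc (2 * i)) = w i" for z w i
    by (auto simp: j_def)
  have "Cantor_copy X (range (h \<circ> j z))" for z
  proof -
    have proj: "continuous_map Cantor_space (discrete_topology UNIV) (\<lambda>w. w k)" for k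
      unfolding Cantor_space_def by (rule continuous_map_product_projection) simp
    have "continuous_map Cantor_space (discrete_topology UNIV) (\<lambda>w. j z w k)" for k
      using proj by (cases "even k") (auto simp: j_def)
    then have "continuous_map Cantor_space Cantor_space (j z)"
      by (subst (2) Cantor_space_def) (simp add: continuous_map_componentwise_UNIV)
    then have "continuous_map Cantor_space X (h \<circ> j z)"
      using h(1) continuous_map_compose by blast
    moreover have "inj (h \<circ> j z)"
      by (intro inj_compose h(2) injI ext) (metis j_odd)
    ultimately show ?thesis
      using Cantor_copy_iff [OF X] by blast
  qed
  moreover have "range (h \<circ> j z) \<subseteq> L" for z
    using h(3) by auto
  moreover have "disjoint_family (\<lambda>z. range (h \<circ> j z))"
    unfolding disjoint_family_on_def
  proof (intro ballI impI)
    fix z z' :: "nat \<Rightarrow> bool" assume "z \<noteq> z'"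
    then obtain i where "z i \<noteq> z' i"
      by auto
    then have "j z w \<noteq> j z' w'" for w w'
      using j_even [of z w i] j_even [of z' w' i] by metis
    then show "range (h \<circ> j z) \<inter> range (h \<circ> j z') = {}"
      using h(2) by (auto dest: injD)
  qed
  ultimately show thesis
    by (rule that)
qed

section \<open>Cantor schemes\<close>

lemma no_isolated_pointsD:
  assumes "no_isolated_points (subtopology X P)" "openin X V" "x \<in> V \<inter> P"
  obtains y where "y \<in> V \<inter> P" "y \<noteq> x"
proof -
  have "V \<inter> P \<noteq> {x}"
  proof
    assume eq: "V \<inter> P = {x}"
    then have "openin (subtopology X P) {x}"
      using assms(2) by (metis openin_subtopology)
    moreover have "x \<in> topspace (subtopology X P)"
      using assms openin_subset by (auto simp: topspace_subtopology)
    ultimately show False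
      using assms(1) by (auto simp: no_isolated_points_def)
  qed
  then show thesis
    using assms(3) that by blast
qed

text \<open>One branching of the scheme: inside an open set meeting a perfect set there is room for two
  disjoint small balls centred on the perfect set, even after deletion of a closed set that is
  nowhere dense in it.\<close>

lemma (in Metric_space) Cantor_scheme_split:
  fixes e :: real
  assumes P: "no_isolated_points (subtopology mtopology P)"
    and F: "closedin mtopology F" and V: "openin mtopology V"
    and nd: "\<not> V \<inter> P \<subseteq> F" and e: "e > 0"
  obtains c :: "bool \<Rightarrow> 'a" and r
  where "\<forall>b. c b \<in> P \<inter> M" "0 < r" "r \<le> e" "\<forall>b. mcball (c b) r \<subseteq> V - F"
    "mcball (c False) r \<inter> mcball (c True) r = {}"
proof -
  have op: "openin mtopology (V - F)"
    using F V by blast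
  obtain x where x: "x \<in> (V - F) \<inter> P"
    using nd by blast
  obtain y where y: "y \<in> (V - F) \<inter> P" "y \<noteq> x"
    using no_isolated_pointsD [OF P op x] .
  have M: "x \<in> M" "y \<in> M"
    using x y openin_subset [OF op] by auto
  obtain r1 where r1: "r1 > 0" "mball x r1 \<subseteq> V - F"
    using op x by (meson IntD1 openin_mtopology)
  obtain r2 where r2: "r2 > 0" "mball y r2 \<subseteq> V - F"
    using op y by (meson IntD1 openin_mtopology)
  (* A third leaves room for closed balls inside the open ones and keeps the two balls apart. *)
  define r where "r = min e (min (min r1 r2) (d x y)) / 3"
  have d: "d x y > 0"
    using M y by simp
  have r: "0 < r" "r \<le> e" "r < r1" "r < r2" "2 * r < d x y"
    using e d r1 r2 by (auto simp: r_def min_def)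
  show thesis
  proof
    show "\<forall>b. (if b then y else x) \<in> P \<inter> M"
      using x y M by auto
    show "0 < r" "r \<le> e"
      using r by auto
    have "mcball x r \<subseteq> V - F" "mcball y r \<subseteq> V - F"
      using r1 r2 r mcball_subset_mball_concentric by blast+
    then show "\<forall>b. mcball (if b then y else x) r \<subseteq> V - F"
      by auto
    have False if "w \<in> mcball x r" "w \<in> mcball y r" for w
      using that triangle [of x w y] r M by (auto simp: commute)
    then have "mcball x r \<inter> mcball y r = {}"
      by blast
    then show "mcball (if False then y else x) r \<inter> mcball (if True then y else x) r = {}"
      by simp
  qed
qed

text \<open>Iterating the branching gives a binary tree of closed balls in which the balls of level
  \<open>n + 1\<close> avoid \<open>F n\<close>. By completeness each branch shrinks to a point of the perfect set,
  and sending a branch to its point embeds the Cantor space.\<close>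

lemma (in Metric_space) Cantor_scheme:
  fixes F :: "nat \<Rightarrow> 'a set"
  assumes complete: "mcomplete"
    and P: "closedin mtopology P" "no_isolated_points (subtopology mtopology P)"
    and U: "openin mtopology U" "U \<inter> P \<noteq> {}"
    and F: "\<And>n. closedin mtopology (F n)"
    and nd: "\<And>n V. openin mtopology V \<Longrightarrow> V \<inter> P \<noteq> {} \<Longrightarrow> \<not> V \<inter> P \<subseteq> F n"
  shows "\<exists>K. Cantor_copy mtopology K \<and> K \<subseteq> U \<inter> P \<and> (\<forall>n. K \<inter> F n = {})"
proof -
  define split where "split n p c \<rho> \<longleftrightarrow> (\<forall>b. c b \<in> P \<inter> M) \<and> 0 < \<rho> \<and> \<rho> \<le> inverse (real (Suc n)) \<and>
      (\<forall>b. mcball (c b) \<rho> \<subseteq> mball (fst p) (snd p) - F n) \<and>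
      mcball (c False) \<rho> \<inter> mcball (c True) \<rho> = {}" for n c \<rho> and p :: "'a \<times> real"
  have split_ex: "\<exists>c \<rho>. split n p c \<rho>" if "fst p \<in> P \<inter> M" "0 < snd p" for n p
  proof -
    have "mball (fst p) (snd p) \<inter> P \<noteq> {}"
      using that by auto
    then have *: "\<not> mball (fst p) (snd p) \<inter> P \<subseteq> F n"
      by (rule nd [rotated]) simp
    have e: "inverse (real (Suc n)) > 0"
      by simp
    obtain c and \<rho> where "\<forall>b. c b \<in> P \<inter> M" "0 < \<rho>" "\<rho> \<le> inverse (real (Suc n))"
      "\<forall>b. mcball (c b) \<rho> \<subseteq> mball (fst p) (snd p) - F n"
      "mcball (c False) \<rho> \<inter> mcball (c True) \<rho> = {}"
      using Cantor_scheme_split [OF P(2) F openin_mball * e] .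
    then have "split n p c \<rho>"
      unfolding split_def by simp
    then show ?thesis
      by blast
  qed
  define c where "c n p = (SOME c. \<exists>\<rho>. split n p c \<rho>)" for n p
  define \<rho> where "\<rho> n p = (SOME \<rho>. split n p (c n p) \<rho>)" for n p
  have "split n p (c n p) (\<rho> n p)" if "fst p \<in> P \<inter> M" "0 < snd p" for n p
  proof -
    have "\<exists>\<rho>. split n p (c n p) \<rho>"
      unfolding c_def using split_ex [OF that] by (rule someI_ex)
    then show ?thesis
      unfolding \<rho>_def by (rule someI_ex)
  qed
  note step = this [unfolded split_def]
  obtain x0 where x0: "x0 \<in> U \<inter> P"
    using U by blast
  then obtain s where s: "s > 0" "mball x0 s \<subseteq> U"
    using U by (meson IntD1 openin_mtopology)
  have x0M: "x0 \<in> M"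
    using x0 U openin_subset by fastforce

  (* Level n of the branch z, as a centre and a radius; it depends only on the first n values
     of z. Halving s puts the closed root ball inside U. *)
  define node :: "(nat \<Rightarrow> bool) \<Rightarrow> nat \<Rightarrow> 'a \<times> real"
    where "node z = rec_nat (x0, s / 2) (\<lambda>n p. (c n p (z n), \<rho> n p))" for z
  have node_0: "node z 0 = (x0, s / 2)"
    and node_Suc: "node z (Suc n) = (c n (node z n) (z n), \<rho> n (node z n))" for z n
    by (auto simp: node_def)
  define B where "B z n = mcball (fst (node z n)) (snd (node z n))" for z n
  have node: "fst (node z n) \<in> P \<inter> M" "0 < snd (node z n)" for z n
    by (induction n) (use x0 x0M s step in \<open>auto simp: node_0 node_Suc\<close>)
  note step = step [OF node]
  have B_0: "B z 0 \<subseteq> U" for z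
    using s mcball_subset_mball_concentric [of "s/2" s x0] by (auto simp: B_def node_0)
  have B_Suc: "B z (Suc n) \<subseteq> B z n - F n" for z n
  proof -
    have "B z (Suc n) \<subseteq> mball (fst (node z n)) (snd (node z n)) - F n"
      using step [of n z n] by (simp add: B_def node_Suc)
    then show ?thesis
      using mball_subset_mcball [of "fst (node z n)" "snd (node z n)"]
      unfolding B_def [of z n] by blast
  qed
  have small: "snd (node z (Suc n)) \<le> inverse (real (Suc n))" for z n
    using step by (simp add: node_Suc)

  have "\<exists>l. l \<in> M \<and> (\<Inter>n. B z n \<inter> P) = {l}" for z
  proof (rule complete [unfolded mcomplete_nest_sing, rule_format], intro conjI allI impI)
    show "closedin mtopology (B z n \<inter> P)" for n
      unfolding B_def using P(1) by (intro closedin_Int closedin_mcball)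
    show "B z n \<inter> P \<noteq> {}" for n
    proof -
      have "fst (node z n) \<in> B z n \<inter> P"
        using node [of z n] by (simp add: B_def)
      then show ?thesis
        by blast
    qed
    show "decseq (\<lambda>n. B z n \<inter> P)"
      using B_Suc by (intro decseq_SucI) blast
    fix e :: real assume "e > 0"
    then obtain n where "inverse (real (Suc n)) < e"
      using reals_Archimedean by blast
    then have "snd (node z (Suc n)) \<le> e"
      using small [of z n] by linarith
    then have "B z (Suc n) \<inter> P \<subseteq> mcball (fst (node z (Suc n))) e"
      unfolding B_def using mcball_subset_concentric by blast
    then show "\<exists>n a. B z n \<inter> P \<subseteq> mcball a e"
      by blast
  qed
  then obtain h where hM: "\<And>z. h z \<in> M" and h: "\<And>z. (\<Inter>n. B z n \<inter> P) = {h z}"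
    by metis
  have hB: "h z \<in> B z n" and hP: "h z \<in> P" for z n
    using h [of z] by auto

  have node_cong: "node z n = node z' n" if "\<forall>i<n. z i = z' i" for z z' n
    using that by (induction n) (auto simp: node_0 node_Suc)
  have "inj h"
  proof (rule injI, rule ccontr)
    fix z z' assume eq: "h z = h z'" and "z \<noteq> z'"
    then have "\<exists>n. z n \<noteq> z' n"
      by auto
    then obtain n where n: "z n \<noteq> z' n" and "\<forall>i<n. z i = z' i"
      using exists_least_iff [of "\<lambda>n. z n \<noteq> z' n"] by blast
    then have same: "node z' n = node z n"
      using node_cong by metis
    have "B z (Suc n) \<inter> B z' (Suc n) = {}"
    proof -
      have "mcball (c n (node z n) False) (\<rho> n (node z n)) \<inter>
            mcball (c n (node z n) True) (\<rho> n (node z n)) = {}"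
        using step [of n z n] by blast
      then show ?thesis
        using n unfolding B_def node_Suc same fst_conv snd_conv
        by (cases "z n"; cases "z' n") (simp_all add: Int_commute)
    qed
    then show False
      using hB [of z "Suc n"] hB [of z' "Suc n"] eq by auto
  qed
  moreover have "continuous_map Cantor_space mtopology h"
    unfolding continuous_map_to_metric
  proof (intro ballI allI impI)
    fix z and e :: real assume "e > 0"
    then obtain n where n: "inverse (real (Suc n)) < e / 2"
      using reals_Archimedean half_gt_zero by blast
    let ?W = "{w :: nat \<Rightarrow> bool. \<forall>i<Suc n. w i = z i}"
    have "h w \<in> mball (h z) e" if "w \<in> ?W" for w
    proof -
      have "node w (Suc n) = node z (Suc n)"
        using that by (intro node_cong) auto
      then have "h w \<in> B z (Suc n)"
        using hB [of w "Suc n"] by (simp add: B_def)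
      then show ?thesis
        using hB [of z "Suc n"] small [of z n] n triangle [of "h z" "fst (node z (Suc n))" "h w"]
        by (auto simp: B_def commute)
    qed
    then show "\<exists>W. openin Cantor_space W \<and> z \<in> W \<and> (\<forall>w\<in>W. h w \<in> mball (h z) e)"
      using openin_Cantor_cylinder [of "Suc n" z] by blast
  qed
  ultimately have "Cantor_copy mtopology (range h)"
    using Cantor_copy_iff [OF Hausdorff_space_mtopology] by blast
  moreover have "range h \<subseteq> U \<inter> P"
    using hB [of _ 0] B_0 hP by blast
  moreover have "range h \<inter> F n = {}" for n
    using hB [of _ "Suc n"] B_Suc by blast
  ultimately show ?thesis
    by blast
qed

text \<open>The scheme, restated without a metric and for countable families.\<close>

lemma Cantor_copy_in_perfect_set_avoiding:
  assumes X: "completely_metrizable_space X" and P: "perfect_set X P"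
    and U: "openin X U" "U \<inter> P \<noteq> {}"
    and F: "countable \<F>" "\<And>C. C \<in> \<F> \<Longrightarrow> closedin X C"
    and nd: "\<And>C V. C \<in> \<F> \<Longrightarrow> openin X V \<Longrightarrow> V \<inter> P \<noteq> {} \<Longrightarrow> \<not> V \<inter> P \<subseteq> C"
  shows "\<exists>K. Cantor_copy X K \<and> K \<subseteq> U \<inter> P \<and> K \<inter> \<Union>\<F> = {}"
proof -
  obtain M d where "Metric_space M d" and M: "Metric_space.mcomplete M d"
    and X: "X = Metric_space.mtopology M d"
    using X by (auto simp: completely_metrizable_space_def)
  interpret Metric_space M d
    by fact
  (* The empty set is added so that the family can be enumerated by the natural numbers. *)
  define G where "G = from_nat_into (insert {} \<F>)"
  have rG: "range G = insert {} \<F>"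
    unfolding G_def using F(1) by (intro range_from_nat_into) auto
  then have G: "G n = {} \<or> G n \<in> \<F>" for n
    by blast
  have "\<exists>K. Cantor_copy mtopology K \<and> K \<subseteq> U \<inter> P \<and> (\<forall>n. K \<inter> G n = {})"
  proof (rule Cantor_scheme [OF M])
    show "closedin mtopology P" "no_isolated_points (subtopology mtopology P)"
      using P X by (auto simp: perfect_set_def)
    show "openin mtopology U" "U \<inter> P \<noteq> {}"
      using U X by auto
    show "closedin mtopology (G n)" for n
      using G [of n] F(2) X by auto
    show "\<not> V \<inter> P \<subseteq> G n" if "openin mtopology V" "V \<inter> P \<noteq> {}" for n V
      using that G [of n] nd X by auto
  qed
  then obtain K where K: "Cantor_copy X K" "K \<subseteq> U \<inter> P" "\<forall>n. K \<inter> G n = {}"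
    using X by blast
  have "K \<inter> \<Union>\<F> = {}"
    using K(3) rG by blast
  with K(1,2) show ?thesis
    by blast
qed

corollary Cantor_copy_in_open_part:
  assumes "completely_metrizable_space X" "perfect_set X P" "openin X U" "U \<inter> P \<noteq> {}"
  shows "\<exists>K. Cantor_copy X K \<and> K \<subseteq> U \<inter> P"
  using Cantor_copy_in_perfect_set_avoiding [OF assms, of "{}"] by auto

text \<open>The closures of the nowhere dense pieces are closed sets of the kind the scheme can avoid.
  The result strengthens the Baire category theorem for \<open>P\<close>, by which \<open>P - S\<close> is non-empty.\<close>

lemma Cantor_copy_avoiding_meager:
  assumes X: "completely_metrizable_space X" and P: "perfect_set X P"
    and S: "meager_in (subtopology X P) S"
  shows "\<exists>K. Cantor_copy X K \<and> K \<subseteq> P \<and> K \<inter> S = {}"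
proof -
  let ?Y = "subtopology X P"
  have clP: "closedin X P" and PX: "P \<subseteq> topspace X"
    using P closedin_subset by (auto simp: perfect_set_def)
  obtain \<N> where \<N>: "countable \<N>" "\<And>N. N \<in> \<N> \<Longrightarrow> nowhere_dense_in ?Y N" "\<Union>\<N> = S"
    using S by (auto simp: meager_in_def union_of_def)
  let ?\<F> = "(\<lambda>N. ?Y closure_of N) ` \<N>"
  have "\<exists>K. Cantor_copy X K \<and> K \<subseteq> topspace X \<inter> P \<and> K \<inter> \<Union>?\<F> = {}"
  proof (rule Cantor_copy_in_perfect_set_avoiding [OF X P, of "topspace X" ?\<F>])
    show "openin X (topspace X)"
      by simp
    show "topspace X \<inter> P \<noteq> {}"
      using P PX by (auto simp: perfect_set_def)
    show "countable ?\<F>"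
      using \<N>(1) by simp
    show "closedin X C" if "C \<in> ?\<F>" for C
      using that closedin_trans_full [OF closedin_closure_of clP] by auto
    show "\<not> V \<inter> P \<subseteq> C" if C: "C \<in> ?\<F>" and V: "openin X V" "V \<inter> P \<noteq> {}" for C V
    proof
      assume "V \<inter> P \<subseteq> C"
      moreover have "openin ?Y (V \<inter> P)"
        using V(1) by (auto simp: openin_subtopology)
      ultimately have "V \<inter> P \<subseteq> ?Y interior_of C"
        by (simp add: interior_of_maximal)
      moreover have "?Y interior_of C = {}"
        using C \<N>(2) by (auto simp: nowhere_dense_in_def)
      ultimately show False
        using V(2) by blast
    qed
  qed
  moreover have "S \<subseteq> \<Union>?\<F>"
  proof -
    have "N \<subseteq> ?Y closure_of N" if "N \<in> \<N>" for N
      using \<N>(2) [OF that] by (intro closure_of_subset) (auto simp: nowhere_dense_in_def)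
    then show ?thesis
      using \<N>(3) by blast
  qed
  ultimately show ?thesis
    by blast
qed

section \<open>Disjoint refinements\<close>

text \<open>Among the fibres of a copy of the Cantor set lying in \<open>L n - C\<close>, at most one contains the
  non-empty set \<open>L m - C\<close>, because fibres are disjoint. So only countably many fibres are
  excluded, and a diagonal sequence indexes one that is not.\<close>

lemma Cantor_copy_shrink:
  fixes L :: "nat \<Rightarrow> 'a set"
  assumes X: "completely_metrizable_space X" and L: "\<And>m. Cantor_copy X (L m)"
    and C: "closedin X C" "\<And>m. \<not> L m \<subseteq> C"
  shows "\<exists>K. Cantor_copy X K \<and> K \<subseteq> L n - C \<and> (\<forall>m. \<not> L m \<subseteq> C \<union> K)"
proof -
  have H: "Hausdorff_space X"
    using X completely_metrizable_imp_metrizable_space metrizable_imp_Hausdorff_space by blast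
  have LX: "L n \<subseteq> topspace X"
    using L by (auto simp: Cantor_copy_def)
  have "(topspace X - C) \<inter> L n \<noteq> {}"
    using C(2) [of n] LX by blast
  then obtain K0 where K0: "Cantor_copy X K0" "K0 \<subseteq> (topspace X - C) \<inter> L n"
    using Cantor_copy_in_open_part [OF X perfect_set_Cantor_copy [OF H L]] C(1)
    by (metis openin_diff openin_topspace)
  obtain K :: "(nat \<Rightarrow> bool) \<Rightarrow> 'a set" where K: "\<And>z. Cantor_copy X (K z)" "\<And>z. K z \<subseteq> K0"
    and disj: "disjoint_family K"
    using Cantor_copy_fibres [OF H K0(1)] by metis
  define b where "b m = (SOME z. L m - C \<subseteq> K z)" for m
  have b: "L m - C \<subseteq> K (b m)" if "L m - C \<subseteq> K z" for m z
    unfolding b_def using that by (rule someI [where P = "\<lambda>z. L m - C \<subseteq> K z"])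
  define z where "z m = (\<not> b m m)" for m
  have "\<not> L m - C \<subseteq> K z" for m
  proof
    assume *: "L m - C \<subseteq> K z"
    have "z \<noteq> b m"
      by (metis z_def)
    then have "K z \<inter> K (b m) = {}"
      using disj by (auto simp: disjoint_family_on_def)
    with * b [OF *] have "L m - C = {}"
      by blast
    then show False
      using C(2) by blast
  qed
  then have "\<not> L m \<subseteq> C \<union> K z" for m
    by blast
  then show ?thesis
    using K(1) [of z] K(2) [of z] K0(2) by blast
qed

text \<open>The refined sets are chosen one after the other, each outside the union \<open>C n\<close> of its
  predecessors; the invariant that no \<open>L m\<close> is covered by \<open>C n\<close> keeps this possible.\<close>

lemma Cantor_copies_disjoint_refinement:
  fixes L :: "nat \<Rightarrow> 'a set"
  assumes X: "completely_metrizable_space X" and L: "\<And>m. Cantor_copy X (L m)"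
  shows "\<exists>K. (\<forall>n. Cantor_copy X (K n)) \<and> (\<forall>n. K n \<subseteq> L n) \<and> disjoint_family K"
proof -
  have H: "Hausdorff_space X"
    using X completely_metrizable_imp_metrizable_space metrizable_imp_Hausdorff_space by blast
  define next_copy where "next_copy n C K \<longleftrightarrow>
      Cantor_copy X K \<and> K \<subseteq> L n - C \<and> (\<forall>m. \<not> L m \<subseteq> C \<union> K)" for n C K
  define k where "k n C = (SOME K. next_copy n C K)" for n C
  have "next_copy n C (k n C)" if "closedin X C \<and> (\<forall>m. \<not> L m \<subseteq> C)" for n C
  proof -
    have "\<exists>K. next_copy n C K"
      unfolding next_copy_def using that by (intro Cantor_copy_shrink [OF X L]) auto
    then show ?thesis
      unfolding k_def by (rule someI_ex)
  qed
  note k = this [unfolded next_copy_def]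
  define C where "C = rec_nat {} (\<lambda>n S. S \<union> k n S)"
  have C_0: "C 0 = {}" and C_Suc: "C (Suc n) = C n \<union> k n (C n)" for n
    by (auto simp: C_def)
  have inv: "closedin X (C n) \<and> (\<forall>m. \<not> L m \<subseteq> C n)" for n
  proof (induction n)
    case 0
    then show ?case
      using perfect_set_Cantor_copy [OF H L] by (auto simp: C_0 perfect_set_def)
  next
    case (Suc n)
    then have *: "Cantor_copy X (k n (C n))" "\<forall>m. \<not> L m \<subseteq> C n \<union> k n (C n)"
      using k [of "C n" n] by auto
    then have "closedin X (k n (C n))"
      using perfect_set_Cantor_copy [OF H] by (auto simp: perfect_set_def)
    with Suc * show ?case
      by (auto simp: C_Suc)
  qed
  have K: "Cantor_copy X (k n (C n)) \<and> k n (C n) \<subseteq> L n - C n" for n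
    using k [of "C n" n] inv [of n] by blast
  have "incseq C"
    by (rule incseq_SucI) (auto simp: C_Suc)
  then have "k m (C m) \<subseteq> C n" if "m < n" for m n
    using that C_Suc [of m] incseqD [of C "Suc m" n] by auto
  then have "k m (C m) \<inter> k n (C n) = {}" if "m < n" for m n
    using that K [of n] by blast
  then have "disjoint_family (\<lambda>n. k n (C n))"
    unfolding disjoint_family_on_def by (metis Int_commute linorder_neqE_nat)
  with K show ?thesis
    by (intro exI [of _ "\<lambda>n. k n (C n)"]) blast
qed

section \<open>Countable perfect meagerness through copies of the Cantor set\<close>

lemma separable_metrizable_imp_second_countable:
  assumes "metrizable_space X" "separable_space X"
  shows "second_countable X"
proof -
  obtain M d where "Metric_space M d" and X: "X = Metric_space.mtopology M d"
    using assms(1) by (auto simp: metrizable_space_def)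
  interpret Metric_space M d
    by fact
  obtain D where D: "countable D" "mtopology closure_of D = topspace mtopology"
    using assms(2) X by (auto simp: separable_space_def)
  let ?\<B> = "(\<lambda>(a, n). mball a (inverse (real (Suc n)))) ` (D \<times> UNIV)"
  have "\<exists>V\<in>?\<B>. x \<in> V \<and> V \<subseteq> U" if U: "openin mtopology U" "x \<in> U" for U x
  proof -
    obtain r where r: "r > 0" "mball x r \<subseteq> U"
      using U by (meson openin_mtopology)
    have xM: "x \<in> M"
      using U openin_subset by fastforce
    obtain n where n: "inverse (real (Suc n)) < r / 2"
      using r reals_Archimedean half_gt_zero by blast
    let ?e = "inverse (real (Suc n))"
    have "D \<inter> mball x ?e \<noteq> {}"
      using D(2) xM unfolding dense_intersects_open by (metis centre_in_mball_iff empty_iff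
          inverse_positive_iff_positive of_nat_0_less_iff openin_mball zero_less_Suc)
    then obtain a where a: "a \<in> D" "a \<in> M" "d x a < ?e"
      by auto
    have "mball a ?e \<subseteq> mball x r"
    proof
      fix y assume "y \<in> mball a ?e"
      then show "y \<in> mball x r"
        using a xM n triangle [of x a y] by auto
    qed
    then have "mball a ?e \<subseteq> U"
      using r(2) by blast
    moreover have "x \<in> mball a ?e"
      using a xM by (simp add: commute)
    moreover have "mball a ?e \<in> ?\<B>"
      using a(1) by (intro image_eqI [of _ _ "(a, n)"]) auto
    ultimately show ?thesis
      by (intro bexI [of _ "mball a ?e"] conjI)
  qed
  then have "\<forall>U x. openin mtopology U \<and> x \<in> U \<longrightarrow> (\<exists>V\<in>?\<B>. x \<in> V \<and> V \<subseteq> U)"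
    by simp
  moreover have "countable ?\<B>" "\<forall>V\<in>?\<B>. openin mtopology V"
    using D(1) by auto
  ultimately show ?thesis
    unfolding X second_countable_def by (intro exI [of _ ?\<B>] conjI)
qed

text \<open>Given perfect sets \<open>P n\<close>, place a copy of the Cantor set in every non-empty trace on \<open>P n\<close>
  of a basic open set. A closed set containing none of these countably many copies contains no
  non-empty relatively open part of any \<open>P n\<close>, so it is nowhere dense in each of them.\<close>

lemma countably_perfectly_meager_if_closed_covers:
  assumes X: "perfect_Polish_space X" and A: "A \<subseteq> topspace X"
    and cov: "\<And>K :: nat \<Rightarrow> 'a set. (\<And>n. Cantor_copy X (K n)) \<Longrightarrow>
      \<exists>F :: nat \<Rightarrow> 'a set. (\<forall>n. closedin X (F n)) \<and> A \<subseteq> (\<Union>n. F n) \<and> (\<forall>m n. \<not> K m \<subseteq> F n)"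
  shows "countably_perfectly_meager X A"
  unfolding countably_perfectly_meager_def
proof (intro conjI allI impI)
  have cX: "completely_metrizable_space X" and "separable_space X"
    using X by (auto simp: perfect_Polish_space_def)
  then have "second_countable X"
    using separable_metrizable_imp_second_countable completely_metrizable_imp_metrizable_space
    by blast
  then obtain \<B> where \<B>: "countable \<B>" "\<And>V. V \<in> \<B> \<Longrightarrow> openin X V"
    and base: "\<And>U x. openin X U \<Longrightarrow> x \<in> U \<Longrightarrow> \<exists>V\<in>\<B>. x \<in> V \<and> V \<subseteq> U"
    by (auto simp: second_countable_def)
  fix P :: "nat \<Rightarrow> 'a set" assume P: "\<forall>n. perfect_set X (P n)"
  have PX: "P n \<subseteq> topspace X" and Pne: "P n \<noteq> {}" for n
    using P closedin_subset by (auto simp: perfect_set_def)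
  define I where "I = {(n, V). V \<in> \<B> \<and> V \<inter> P n \<noteq> {}}"
  have "countable I"
    by (rule countable_subset [of _ "UNIV \<times> \<B>"]) (use \<B>(1) in \<open>auto simp: I_def\<close>)
  moreover have "I \<noteq> {}"
    using base [of "topspace X"] Pne [of 0] PX [of 0] by (fastforce simp: I_def)
  ultimately have rI: "range (from_nat_into I) = I"
    by (rule range_from_nat_into [rotated])
  have "\<exists>K. Cantor_copy X K \<and> K \<subseteq> snd i \<inter> P (fst i)" if "i \<in> I" for i
    using that by (intro Cantor_copy_in_open_part [OF cX]) (use P \<B>(2) in \<open>auto simp: I_def\<close>)
  then obtain k where k: "\<And>i. i \<in> I \<Longrightarrow> Cantor_copy X (k i) \<and> k i \<subseteq> snd i \<inter> P (fst i)"
    by metis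
  have "Cantor_copy X (k (from_nat_into I j))" for j
    using k rI by blast
  then obtain F :: "nat \<Rightarrow> 'a set" where F: "\<And>n. closedin X (F n)" "A \<subseteq> (\<Union>n. F n)"
    and "\<And>m n. \<not> k (from_nat_into I m) \<subseteq> F n"
    using cov [of "\<lambda>j. k (from_nat_into I j)"] by blast
  then have avoid: "\<not> k i \<subseteq> F n" if "i \<in> I" for i n
    using that rI by (metis rangeE)
  have "nowhere_dense_in (subtopology X (P n)) (F j \<inter> P n)" for n j
  proof -
    let ?Y = "subtopology X (P n)"
    have cl: "closedin ?Y (F j \<inter> P n)"
      using F(1) by (auto simp: closedin_subtopology)
    have "W = {}" if "openin ?Y W" and W: "W \<subseteq> F j \<inter> P n" for W
    proof (rule ccontr)
      obtain V where V: "openin X V" "W = V \<inter> P n"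
        using \<open>openin ?Y W\<close> by (auto simp: openin_subtopology)
      assume "W \<noteq> {}"
      then obtain x where "x \<in> V" "x \<in> P n"
        using V by blast
      then obtain B where "B \<in> \<B>" "x \<in> B" "B \<subseteq> V"
        using base V by blast
      then have "(n, B) \<in> I" and "B \<inter> P n \<subseteq> F j"
        using \<open>x \<in> P n\<close> V W by (auto simp: I_def)
      then show False
        using avoid k by fastforce
    qed
    then have "?Y interior_of (F j \<inter> P n) = {}"
      using interior_of_subset openin_interior_of by metis
    then show ?thesis
      using cl closedin_subset by (fastforce simp: nowhere_dense_in_def closure_of_closedin)
  qed
  then have "meager_in (subtopology X (P n)) ((\<Union>j. F j) \<inter> P n)" for n
    unfolding meager_in_def union_of_def
    by (intro exI [of _ "range (\<lambda>j. F j \<inter> P n)"]) auto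
  moreover have "fsigma_in X (\<Union>j. F j)"
    unfolding fsigma_in_def union_of_def
    by (intro exI [of _ "range F"]) (use F(1) in auto)
  ultimately show "\<exists>F. fsigma_in X F \<and> A \<subseteq> F \<and> (\<forall>n. meager_in (subtopology X (P n)) (F \<inter> P n))"
    using F(2) by blast
qed (rule A)

text \<open>The form in which countable perfect meagerness is used: copies of the Cantor set inside
  the perfect sets witness that the \<open>F\<^sub>\<sigma>\<close>-set is small in each of them. Both the \<open>s\<^sub>0\<close> property
  and the covers that contain no given copy of the Cantor set follow from this.\<close>

lemma countably_perfectly_meagerD:
  fixes P :: "nat \<Rightarrow> 'a set"
  assumes X: "completely_metrizable_space X" and A: "countably_perfectly_meager X A"
    and P: "\<And>n. perfect_set X (P n)"
  shows "\<exists>F. fsigma_in X F \<and> A \<subseteq> F \<and> (\<forall>n. \<exists>K. Cantor_copy X K \<and> K \<subseteq> P n \<and> K \<inter> F = {})"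
proof -
  obtain F where F: "fsigma_in X F" "A \<subseteq> F"
    and meager: "\<And>n. meager_in (subtopology X (P n)) (F \<inter> P n)"
    using A P unfolding countably_perfectly_meager_def by metis
  have "\<exists>K. Cantor_copy X K \<and> K \<subseteq> P n \<and> K \<inter> F = {}" for n
  proof -
    obtain K where K: "Cantor_copy X K" "K \<subseteq> P n" "K \<inter> (F \<inter> P n) = {}"
      using Cantor_copy_avoiding_meager [OF X P meager] by blast
    then have "K \<inter> F = {}"
      by blast
    with K(1,2) show ?thesis
      by blast
  qed
  with F show ?thesis
    by blast
qed

lemma countably_perfectly_meager_imp_s0_set:
  assumes X: "completely_metrizable_space X" and A: "countably_perfectly_meager X A"
  shows "s0_set X A"
  unfolding s0_set_def
proof (intro conjI allI impI)
  show "A \<subseteq> topspace X"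
    using A by (simp add: countably_perfectly_meager_def)
  fix P assume "perfect_set X P"
  then obtain F K where "A \<subseteq> F" and K: "Cantor_copy X K" "K \<subseteq> P" "K \<inter> F = {}"
    using countably_perfectly_meagerD [OF X A, of "\<lambda>_. P"] by blast
  then have "K \<inter> A = {}"
    by blast
  with K show "\<exists>K. Cantor_copy X K \<and> K \<subseteq> P \<and> K \<inter> A = {}"
    by blast
qed

theorem theorem2p1:
  fixes X :: "'a topology" and A :: "'a set"
  assumes "perfect_Polish_space X" and "A \<subseteq> topspace X"
  shows
    "(countably_perfectly_meager X A \<longleftrightarrow>
        (\<forall>K :: nat \<Rightarrow> 'a set. (\<forall>n. Cantor_copy X (K n)) \<longrightarrow>
           (\<exists>F. fsigma_in X F \<and> A \<subseteq> F \<and> (\<forall>m. \<not> K m \<subseteq> F)))) \<and>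
     (countably_perfectly_meager X A \<longleftrightarrow>
        (\<forall>K :: nat \<Rightarrow> 'a set. (\<forall>n. Cantor_copy X (K n)) \<longrightarrow>
           (\<exists>F :: nat \<Rightarrow> 'a set. (\<forall>n. closedin X (F n)) \<and> A \<subseteq> (\<Union>n. F n) \<and>
              (\<forall>m n. \<not> K m \<subseteq> F n)))) \<and>
     (countably_perfectly_meager X A \<longleftrightarrow>
        (\<forall>K :: nat \<Rightarrow> 'a set. (\<forall>n. Cantor_copy X (K n)) \<and> disjoint_family K \<longrightarrow>
           (\<exists>F :: nat \<Rightarrow> 'a set. (\<forall>n. closedin X (F n)) \<and> A \<subseteq> (\<Union>n. F n) \<and>
              (\<forall>m n. \<not> K m \<subseteq> F n)))) \<and>
     (countably_perfectly_meager X A \<longleftrightarrow>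
        s0_set X A \<and>
        (\<forall>K :: nat \<Rightarrow> 'a set.
           (\<forall>n. Cantor_copy X (K n)) \<and> disjoint_family K \<and> (\<forall>n. K n \<inter> A = {}) \<longrightarrow>
           (\<exists>F :: nat \<Rightarrow> 'a set. (\<forall>n. closedin X (F n)) \<and> A \<subseteq> (\<Union>n. F n) \<and>
              (\<forall>m n. \<not> K m \<subseteq> F n))))"
proof -
  let ?M = "countably_perfectly_meager X A"
  let ?cov = "\<lambda>K :: nat \<Rightarrow> 'a set. \<exists>F :: nat \<Rightarrow> 'a set. (\<forall>n. closedin X (F n)) \<and>
    A \<subseteq> (\<Union>n. F n) \<and> (\<forall>m n. \<not> K m \<subseteq> F n)"
  let ?sigma = "\<forall>K :: nat \<Rightarrow> 'a set. (\<forall>n. Cantor_copy X (K n)) \<longrightarrow>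
    (\<exists>F. fsigma_in X F \<and> A \<subseteq> F \<and> (\<forall>m. \<not> K m \<subseteq> F))"
  let ?all = "\<forall>K :: nat \<Rightarrow> 'a set. (\<forall>n. Cantor_copy X (K n)) \<longrightarrow> ?cov K"
  let ?disj = "\<forall>K :: nat \<Rightarrow> 'a set. (\<forall>n. Cantor_copy X (K n)) \<and> disjoint_family K \<longrightarrow> ?cov K"
  let ?off = "\<forall>K :: nat \<Rightarrow> 'a set.
    (\<forall>n. Cantor_copy X (K n)) \<and> disjoint_family K \<and> (\<forall>n. K n \<inter> A = {}) \<longrightarrow> ?cov K"
  have X: "completely_metrizable_space X"
    using assms(1) by (simp add: perfect_Polish_space_def)
  then have H: "Hausdorff_space X"
    using completely_metrizable_imp_metrizable_space metrizable_imp_Hausdorff_space by blast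
  have cov_mono: "?cov L" if "?cov K" "\<And>n. K n \<subseteq> L n" for K L
    using that by (meson order_trans)

  have sigma: ?sigma if ?M
  proof (intro allI impI)
    fix K :: "nat \<Rightarrow> 'a set" assume "\<forall>n. Cantor_copy X (K n)"
    then have "perfect_set X (K n)" for n
      using perfect_set_Cantor_copy [OF H] by blast
    then obtain F where F: "fsigma_in X F" "A \<subseteq> F"
      "\<forall>n. \<exists>K'. Cantor_copy X K' \<and> K' \<subseteq> K n \<and> K' \<inter> F = {}"
      using countably_perfectly_meagerD [OF X \<open>?M\<close>, of K] by blast
    have "\<not> K m \<subseteq> F" for m
    proof -
      obtain K' where K': "Cantor_copy X K'" "K' \<subseteq> K m" "K' \<inter> F = {}"
        using F(3) by blast
      have "K' \<noteq> {}"
        using perfect_set_Cantor_copy [OF H K'(1)] by (simp add: perfect_set_def)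
      then show ?thesis
        using K' by blast
    qed
    with F show "\<exists>F. fsigma_in X F \<and> A \<subseteq> F \<and> (\<forall>m. \<not> K m \<subseteq> F)"
      by blast
  qed
  have all: ?all if ?sigma
  proof (intro allI impI)
    fix K :: "nat \<Rightarrow> 'a set" assume "\<forall>n. Cantor_copy X (K n)"
    with that obtain F where F: "fsigma_in X F" "A \<subseteq> F" "\<And>m. \<not> K m \<subseteq> F"
      by meson
    then obtain C :: "nat \<Rightarrow> 'a set" where C: "\<forall>n. closedin X (C n)" "(\<Union>n. C n) = F"
      using fsigma_in_ascending [of X F] by auto
    have "\<not> K m \<subseteq> C n" for m n
      using F(3) [of m] C(2) by blast
    with C F(2) show "?cov K"
      by (intro exI [of _ C]) simp
  qed
  have M: ?M if ?all
    by (rule countably_perfectly_meager_if_closed_covers [OF assms])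
      (rule that [THEN spec, THEN mp], blast)
  have disj: ?all if ?disj
  proof (intro allI impI)
    fix L :: "nat \<Rightarrow> 'a set" assume L: "\<forall>n. Cantor_copy X (L n)"
    then obtain K where K: "\<And>n. Cantor_copy X (K n)" "\<And>n. K n \<subseteq> L n" "disjoint_family K"
      using Cantor_copies_disjoint_refinement [OF X, of L] by blast
    have "?cov K"
      by (rule that [THEN spec, THEN mp]) (use K in blast)
    then show "?cov L"
      by (rule cov_mono) (rule K(2))
  qed
  have off: ?all if s0: "s0_set X A" and ?off
  proof (intro allI impI)
    fix L :: "nat \<Rightarrow> 'a set" assume "\<forall>n. Cantor_copy X (L n)"
    then have "\<forall>n. \<exists>L'. Cantor_copy X L' \<and> L' \<subseteq> L n \<and> L' \<inter> A = {}"
      using s0 perfect_set_Cantor_copy [OF H] unfolding s0_set_def by blast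
    then obtain L' where L': "\<And>n. Cantor_copy X (L' n)" "\<And>n. L' n \<subseteq> L n" "\<And>n. L' n \<inter> A = {}"
      by metis
    obtain K where K: "\<And>n. Cantor_copy X (K n)" "\<And>n. K n \<subseteq> L' n" "disjoint_family K"
      using Cantor_copies_disjoint_refinement [OF X, of L'] L'(1) by blast
    (* The refinement stays disjoint from A because it lies inside the sets L' n. *)
    have "K n \<inter> A = {}" for n
      using K(2) L'(3) by blast
    with K have "?cov K"
      by (intro \<open>?off\<close> [THEN spec, THEN mp]) blast
    moreover have "K n \<subseteq> L n" for n
      using K(2) L'(2) by blast
    ultimately show "?cov L"
      by (rule cov_mono)
  qed
  have s0: "s0_set X A" if ?M
    using countably_perfectly_meager_imp_s0_set [OF X that] .
  have "?M \<longleftrightarrow> ?sigma" "?M \<longleftrightarrow> ?all"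
    using sigma all M by argo+
  moreover have "?M \<longleftrightarrow> ?disj"
  proof
    show ?disj if ?M
      using all [OF sigma [OF that]] by simp
  qed (rule M, rule disj)
  moreover have "?M \<longleftrightarrow> s0_set X A \<and> ?off"
  proof
    show "s0_set X A \<and> ?off" if ?M
      using s0 [OF that] all [OF sigma [OF that]] by simp
    show ?M if "s0_set X A \<and> ?off"
      using M off that by argo
  qed
  ultimately show ?thesis
    by (intro conjI)
qed

end
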